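(* A Banach function space $X$ on $[0,1]$ has the order Banach-Saks property ($oBSP$) if and only if it has the hereditary order Banach-Saks property ($hoBSP$).
   Context: $L^0$ is the vector lattice of real measurable functions on $[0,1]$ (Lebesgue measure), modulo a.e. equality; inequalities are a.e. A Banach function space $X$ on $[0,1]$ is a Banach space that is a linear subspace of $L^0$ such that $f\in X$ and $\|f\|_X\le\|g\|_X$ whenever $f \in L^0$, $g\in X$ and $|f|\le|g|$. A sequence $\{f_n\}$ in $X$ order converges to $f\in X$ if there is a sequence $\{g_n\}$ in $X$ with $g_n\downarrow0$ and $|f_n-f|\le g_n$ for all $n$; equivalently, $f_n\to f$ a.e. and there is $0\le h\in X$ with $|f_n|\le h$ for all $n$. The Cesàro sequence of $\{f_n\}$ is $\{\frac1m\sum_{n=1}^m f_n\}_m$. $X$ has $oBSP$ if every norm bounded sequence in $X$ has a subsequence whose Cesàro sequence order converges in $X$. $X$ has $hoBSP$ if every norm bounded sequence in $X$ has a subsequence such that the Cesàro sequences of all its further subsequences order converge in $X$ to the same limit. *)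

theory Defs
  imports "HOL-Analysis.Analysis"
begin

text \<open>
  Elements of \<open>L\<^sup>0\<close> are represented by measurable functions, and equality and order are taken
  almost everywhere with respect to Lebesgue measure on \<open>[0,1]\<close> (values outside \<open>[0,1]\<close> play
  no role). A function space is a set of such representatives together with a
  norm, whose values outside that set are irrelevant.
\<close>

abbreviation unit_leb :: "real measure" where
  "unit_leb \<equiv> lebesgue_on {0..1}"

definition ae_le :: "(real \<Rightarrow> real) \<Rightarrow> (real \<Rightarrow> real) \<Rightarrow> bool" where
  "ae_le f g \<longleftrightarrow> (AE x in unit_leb. f x \<le> g x)"

text \<open>
  By \<open>solid\<close>, the carrier is saturated under almost everywhere equality and the norm
  depends only on the equivalence class.
\<close>

locale banach_function_space =
  fixes X :: "(real \<Rightarrow> real) set" and N :: "(real \<Rightarrow> real) \<Rightarrow> real"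
  assumes measurable: "f \<in> X \<Longrightarrow> f \<in> borel_measurable unit_leb"
    and zero_mem: "(\<lambda>x. 0) \<in> X"
    and add_mem: "\<lbrakk>f \<in> X; g \<in> X\<rbrakk> \<Longrightarrow> (\<lambda>x. f x + g x) \<in> X"
    and scale_mem: "f \<in> X \<Longrightarrow> (\<lambda>x. c * f x) \<in> X"
    and norm_nonneg: "f \<in> X \<Longrightarrow> 0 \<le> N f"
    and norm_eq_zero: "f \<in> X \<Longrightarrow> N f = 0 \<longleftrightarrow> (AE x in unit_leb. f x = 0)"
    and norm_scale: "f \<in> X \<Longrightarrow> N (\<lambda>x. c * f x) = \<bar>c\<bar> * N f"
    and norm_triangle: "\<lbrakk>f \<in> X; g \<in> X\<rbrakk> \<Longrightarrow> N (\<lambda>x. f x + g x) \<le> N f + N g"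
    and norm_complete:
      "\<lbrakk>\<And>n. u n \<in> X;
        \<forall>e>0. \<exists>K. \<forall>m\<ge>K. \<forall>n\<ge>K. N (\<lambda>x. u m x - u n x) < e\<rbrakk>
        \<Longrightarrow> \<exists>f\<in>X. (\<lambda>n. N (\<lambda>x. u n x - f x)) \<longlonglongrightarrow> 0"
    and solid:
      "\<lbrakk>f \<in> borel_measurable unit_leb; g \<in> X; ae_le (\<lambda>x. \<bar>f x\<bar>) (\<lambda>x. \<bar>g x\<bar>)\<rbrakk>
        \<Longrightarrow> f \<in> X \<and> N f \<le> N g"

text \<open>\<open>g n \<down> 0\<close> in \<open>X\<close>: the sequence decreases and its infimum in \<open>X\<close> is \<open>0\<close>.\<close>

definition decreases_to_zero ::
    "(real \<Rightarrow> real) set \<Rightarrow> (nat \<Rightarrow> real \<Rightarrow> real) \<Rightarrow> bool" where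
  "decreases_to_zero X g \<longleftrightarrow>
     (\<forall>n. g n \<in> X) \<and>
     (\<forall>n. ae_le (g (Suc n)) (g n)) \<and>
     (\<forall>n. ae_le (\<lambda>x. 0) (g n)) \<and>
     (\<forall>h\<in>X. (\<forall>n. ae_le h (g n)) \<longrightarrow> ae_le h (\<lambda>x. 0))"

definition order_converges ::
    "(real \<Rightarrow> real) set \<Rightarrow> (nat \<Rightarrow> real \<Rightarrow> real) \<Rightarrow> (real \<Rightarrow> real) \<Rightarrow> bool" where
  "order_converges X f l \<longleftrightarrow>
     (\<forall>n. f n \<in> X) \<and> l \<in> X \<and>
     (\<exists>g. decreases_to_zero X g \<and> (\<forall>n. ae_le (\<lambda>x. \<bar>f n x - l x\<bar>) (g n)))"

text \<open>Sequences are indexed from \<open>0\<close>, so the \<open>m\<close>-th term averages \<open>Suc m\<close> functions.\<close>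

definition cesaro :: "(nat \<Rightarrow> real \<Rightarrow> real) \<Rightarrow> nat \<Rightarrow> real \<Rightarrow> real" where
  "cesaro f m = (\<lambda>x. (\<Sum>n\<le>m. f n x) / real (Suc m))"

definition norm_bounded_seq ::
    "(real \<Rightarrow> real) set \<Rightarrow> ((real \<Rightarrow> real) \<Rightarrow> real) \<Rightarrow> (nat \<Rightarrow> real \<Rightarrow> real) \<Rightarrow> bool" where
  "norm_bounded_seq X N f \<longleftrightarrow> (\<forall>n. f n \<in> X) \<and> (\<exists>C. \<forall>n. N (f n) \<le> C)"

definition oBSP :: "(real \<Rightarrow> real) set \<Rightarrow> ((real \<Rightarrow> real) \<Rightarrow> real) \<Rightarrow> bool" where
  "oBSP X N \<longleftrightarrow>
     (\<forall>f. norm_bounded_seq X N f \<longrightarrow>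
       (\<exists>r :: nat \<Rightarrow> nat. strict_mono r \<and> (\<exists>l. order_converges X (cesaro (f \<circ> r)) l)))"

definition hoBSP :: "(real \<Rightarrow> real) set \<Rightarrow> ((real \<Rightarrow> real) \<Rightarrow> real) \<Rightarrow> bool" where
  "hoBSP X N \<longleftrightarrow>
     (\<forall>f. norm_bounded_seq X N f \<longrightarrow>
       (\<exists>r :: nat \<Rightarrow> nat. strict_mono r \<and>
         (\<exists>l. \<forall>s :: nat \<Rightarrow> nat. strict_mono s \<longrightarrow> order_converges X (cesaro (f \<circ> r \<circ> s)) l)))"

end

theory Submission
  imports Defs
begin

text \<open>
  Identify subsequences with infinite sets \<open>S\<close> of indices. Under \<open>oBSP\<close> the set of those \<open>S\<close>
  whose Cesaro means order converge is Borel: pointwise convergence almost everywhere is a Borel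
  condition by Fubini, and \<open>oBSP\<close> forces norm bounded increasing sequences to be order bounded,
  so the Cesaro means are order bounded iff the norms of their finite maxima are bounded, a
  countable condition on initial segments of \<open>S\<close>. By the Galvin-Prikry theorem there is an infinite
  \<open>M\<close> such that either all or none of its infinite subsets belong to this set, and \<open>oBSP\<close> applied
  along \<open>M\<close> excludes the second case. The limit is then independent of the subset, as otherwise
  alternating long blocks of two subsets would produce divergent means.
\<close>

section \<open>Completely Ramsey sets\<close>

text \<open>The Ramsey property relative to every finite stem \<open>a\<close>, not only the empty
  one: closure under countable unions needs the dichotomy at all stems. The stem need not lie below
  \<open>M\<close>, since \<open>N\<close> can be shrunk to lie above it.\<close>

definition completely_ramsey :: "nat set set \<Rightarrow> bool" where
  "completely_ramsey A \<longleftrightarrow>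
     (\<forall>a M. finite a \<longrightarrow> infinite M \<longrightarrow>
       (\<exists>N\<subseteq>M. infinite N \<and>
         ((\<forall>S\<subseteq>N. infinite S \<longrightarrow> a \<union> S \<in> A) \<or> (\<forall>S\<subseteq>N. infinite S \<longrightarrow> a \<union> S \<notin> A))))"

text \<open>Shrink the set once for each element of \<open>B\<close>; heredity preserves what was
  achieved before.\<close>

lemma finite_refinement:
  fixes P :: "'b \<Rightarrow> 'a set \<Rightarrow> bool"
  assumes "finite B" "infinite M"
    and hered: "\<And>b N N'. \<lbrakk>P b N; N' \<subseteq> N; infinite N'\<rbrakk> \<Longrightarrow> P b N'"
    and dense: "\<And>b N. \<lbrakk>b \<in> B; N \<subseteq> M; infinite N\<rbrakk> \<Longrightarrow> \<exists>N'\<subseteq>N. infinite N' \<and> P b N'"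
  shows "\<exists>N\<subseteq>M. infinite N \<and> (\<forall>b\<in>B. P b N)"
  using \<open>finite B\<close> dense
proof (induction B)
  case empty
  then show ?case using \<open>infinite M\<close> by blast
next
  case (insert b B)
  then obtain N where N: "N \<subseteq> M" "infinite N" "\<forall>b\<in>B. P b N" by (metis insertCI)
  then obtain N' where "N' \<subseteq> N" "infinite N'" "P b N'"
    using insert.prems[of b N] by blast
  then show ?case using N hered by (metis insert_iff subset_trans)
qed

text \<open>A diagonal argument: build decreasing sets \<open>Ns k\<close>, where
  \<open>Ns (Suc k)\<close> satisfies \<open>P b\<close> for every \<open>b\<close> bounded by the
  minimum of \<open>Ns k\<close>. The minima form the required set, since the ones above
  \<open>b\<close> all lie in a stage that has handled \<open>b\<close>.\<close>

lemma fusion: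
  fixes P :: "nat set \<Rightarrow> nat set \<Rightarrow> bool"
  assumes "infinite M"
    and hered: "\<And>b N N'. \<lbrakk>P b N; N' \<subseteq> N; infinite N'\<rbrakk> \<Longrightarrow> P b N'"
    and dense: "\<And>b N. \<lbrakk>finite b; N \<subseteq> M; infinite N\<rbrakk> \<Longrightarrow> \<exists>N'\<subseteq>N. infinite N' \<and> P b N'"
  shows "\<exists>M'\<subseteq>M. infinite M' \<and> (\<forall>b\<subseteq>M'. finite b \<longrightarrow> P b {n \<in> M'. \<forall>k\<in>b. k < n})"
proof -
  \<comment> \<open>The empty \<open>b\<close> has no maximum from which to read off a stage, and
    all minima, including the first, lie beyond it. Hence \<open>P {}\<close> is already required of
    the initial set.\<close>
  define good where "good N \<longleftrightarrow> infinite N \<and> N \<subseteq> M \<and> P {} N" for N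
  have "\<exists>Ns. \<forall>k. good (Ns k) \<and> Ns (Suc k) \<subseteq> Ns k \<inter> {Inf (Ns k)<..} \<and>
           (\<forall>b\<in>Pow {..Inf (Ns k)}. P b (Ns (Suc k)))"
  proof (intro dependent_nat_choice)
    show "\<exists>N. good N"
      using dense[of "{}" M] \<open>infinite M\<close> by (auto simp: good_def)
  next
    fix N and k :: nat assume N: "good N"
    let ?N = "N \<inter> {Inf N<..}"
    have inf: "infinite ?N"
    proof
      assume "finite ?N"
      moreover have "N \<subseteq> ?N \<union> {..Inf N}" by auto
      ultimately have "finite N" by (meson finite_UnI finite_atMost finite_subset)
      then show False using N by (simp add: good_def)
    qed
    \<comment> \<open>Only finitely many \<open>b\<close> are bounded by \<open>Inf N\<close>, so
      one finite refinement treats them all.\<close>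
    have "\<exists>N'\<subseteq>?N. infinite N' \<and> (\<forall>b\<in>Pow {..Inf N}. P b N')"
    proof (rule finite_refinement)
      fix b N' assume "b \<in> Pow {..Inf N}" "N' \<subseteq> ?N" "infinite N'"
      moreover have "N \<subseteq> M" using N by (simp add: good_def)
      ultimately show "\<exists>N''\<subseteq>N'. infinite N'' \<and> P b N''"
        by (intro dense) (auto intro: finite_subset)
    qed (use inf hered in auto)
    then obtain N' where N': "N' \<subseteq> ?N" "infinite N'" "\<forall>b\<in>Pow {..Inf N}. P b N'"
      by blast
    then have "good N'" using N hered unfolding good_def by blast
    then show "\<exists>N'. good N' \<and> N' \<subseteq> N \<inter> {Inf N<..} \<and> (\<forall>b\<in>Pow {..Inf N}. P b N')"
      using N' by blast
  qed
  then obtain Ns where Ns: "\<And>k. good (Ns k)" "\<And>k. Ns (Suc k) \<subseteq> Ns k \<inter> {Inf (Ns k)<..}"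
      "\<And>k b. b \<subseteq> {..Inf (Ns k)} \<Longrightarrow> P b (Ns (Suc k))"
    by (metis PowI)
  define m where "m k = Inf (Ns k)" for k
  have m_in: "m k \<in> Ns k" for k
  proof -
    have "Ns k \<noteq> {}" using Ns(1)[of k] by (auto simp: good_def)
    then show ?thesis by (simp add: m_def Inf_nat_def1)
  qed
  have "decseq Ns"
    by (rule decseq_SucI) (use Ns(2) in blast)
  then have Ns_mono: "Ns j \<subseteq> Ns k" if "k \<le> j" for j k
    using that by (rule decseqD)
  have sm: "strict_mono m"
    using Ns(2) m_in by (auto simp: strict_mono_Suc_iff m_def)
  have inf: "infinite (range m)"
    using sm by (simp add: range_inj_infinite strict_mono_imp_inj_on)
  have "P b {n \<in> range m. \<forall>k\<in>b. k < n}" if b: "b \<subseteq> range m" "finite b" for b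
  proof (cases "b = {}")
    case True
    have "range m \<subseteq> Ns 0" using m_in Ns_mono by blast
    then show ?thesis using True hered[of "{}" "Ns 0" "range m"] Ns(1)[of 0] inf
      by (simp add: good_def full_SetCompr_eq)
  next
    case False
    then obtain i where i: "Max b = m i" using b Max_in by blast
    have eq: "{n \<in> range m. \<forall>k\<in>b. k < n} = m ` {i<..}"
      using b False sm i by (auto simp: strict_mono_less simp flip: Max_less_iff)
    have "m ` {i<..} \<subseteq> Ns (Suc i)" using m_in Ns_mono by (auto simp: Suc_le_eq intro!: set_mp[OF Ns_mono m_in])
    moreover have "infinite (m ` {i<..})"
      using sm by (simp add: finite_image_iff strict_mono_imp_inj_on infinite_Ioi inj_on_subset)
    moreover have "P b (Ns (Suc i))"
      using b i by (intro Ns(3)) (auto simp flip: m_def i)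
    ultimately show ?thesis unfolding eq using hered by blast
  qed
  moreover have "range m \<subseteq> M"
    using m_in Ns(1) by (auto simp: good_def)
  ultimately show ?thesis using inf by blast
qed

lemma infinite_nat_initial_part:
  fixes S :: "nat set"
  assumes "infinite S"
  obtains b where "b \<subseteq> S" "finite b" "card b = i" "\<And>k n. \<lbrakk>k \<in> b; n \<in> S - b\<rbrakk> \<Longrightarrow> k < n"
proof
  let ?b = "enumerate S ` {..<i}"
  show "?b \<subseteq> S" using assms by (auto simp: enumerate_in_set)
  show "card ?b = i"
    using assms by (simp add: card_image inj_on_subset[OF inj_enumerate])
  fix k n assume "k \<in> ?b" "n \<in> S - ?b"
  then obtain j where "n = enumerate S j" "j \<ge> i"
    by (metis DiffE assms enumerate_Ex image_eqI lessThan_iff not_le)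
  with \<open>k \<in> ?b\<close> show "k < n" using assms by (auto simp: enumerate_mono_iff)
qed simp

text \<open>Nash-Williams forcing: after one fusion every finite \<open>b\<close> is either accepted (all its
  infinite extensions lie in the union) or rejected (this fails on every infinite subset), and
  after a second one rejection passes from \<open>b\<close> to all its one-point end-extensions. A set in
  \<open>A i\<close> would then contradict the rejection of its first \<open>i\<close> elements.\<close>

lemma completely_ramsey_UN:
  fixes A :: "nat \<Rightarrow> nat set set"
  assumes A: "\<And>i. completely_ramsey (A i)"
  shows "completely_ramsey (\<Union>i. A i)"
  unfolding completely_ramsey_def
proof (intro allI impI)
  fix a M :: "nat set" assume a: "finite a" and M: "infinite M"
  define acc where "acc b N \<longleftrightarrow> (\<forall>S\<subseteq>N. infinite S \<longrightarrow> a \<union> b \<union> S \<in> (\<Union>i. A i))" for b N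
  define rej where "rej b N \<longleftrightarrow> (\<forall>N'\<subseteq>N. infinite N' \<longrightarrow> \<not> acc b N')" for b N
  \<comment> \<open>Only the indices \<open>i \<le> card b\<close> will be decided at the stem
    \<open>b\<close>. These are finitely many for each \<open>b\<close>, yet every \<open>i\<close>
    is reached by stems that are large enough.\<close>
  define decides where "decides b i N \<longleftrightarrow>
    (\<forall>S\<subseteq>N. infinite S \<longrightarrow> a \<union> b \<union> S \<in> A i) \<or> (\<forall>S\<subseteq>N. infinite S \<longrightarrow> a \<union> b \<union> S \<notin> A i)" for b i N
  define beyond :: "nat set \<Rightarrow> nat set \<Rightarrow> nat set"
    where "beyond b N = {n \<in> N. \<forall>k\<in>b. k < n}" for b N
  have "\<exists>M'\<subseteq>M. infinite M' \<and> (\<forall>b\<subseteq>M'. finite b \<longrightarrow>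
      (\<forall>i\<in>{..card b}. decides b i {n \<in> M'. \<forall>k\<in>b. k < n}) \<and>
      (acc b {n \<in> M'. \<forall>k\<in>b. k < n} \<or> rej b {n \<in> M'. \<forall>k\<in>b. k < n}))"
  proof (rule fusion[OF M])
    fix b N N'
    assume *: "(\<forall>i\<in>{..card b}. decides b i N) \<and> (acc b N \<or> rej b N)" "N' \<subseteq> N" "infinite N'"
    have "decides b i N \<Longrightarrow> decides b i N'" for i
      using *(2) unfolding decides_def by (meson subset_trans)
    moreover have "acc b N \<Longrightarrow> acc b N'" "rej b N \<Longrightarrow> rej b N'"
      using *(2) unfolding acc_def rej_def by (meson subset_trans)+
    ultimately show "(\<forall>i\<in>{..card b}. decides b i N') \<and> (acc b N' \<or> rej b N')"
      using * by blast
  next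
    fix b N :: "nat set" assume b: "finite b" and N: "infinite N"
    have "\<exists>N'\<subseteq>N. infinite N' \<and> (\<forall>i\<in>{..card b}. decides b i N')"
    proof (rule finite_refinement)
      fix i N' N'' assume "decides b i N'" "N'' \<subseteq> N'"
      then show "decides b i N''" unfolding decides_def by (meson subset_trans)
    next
      fix i and N' :: "nat set" assume "infinite N'"
      then show "\<exists>N''\<subseteq>N'. infinite N'' \<and> decides b i N''"
        using A[of i] a b unfolding completely_ramsey_def decides_def
        by (metis finite_UnI)
    qed (use N in auto)
    then obtain N' where N': "N' \<subseteq> N" "infinite N'" "\<forall>i\<in>{..card b}. decides b i N'" by blast
    show "\<exists>N'\<subseteq>N. infinite N' \<and> (\<forall>i\<in>{..card b}. decides b i N') \<and> (acc b N' \<or> rej b N')"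
    proof (cases "rej b N'")
      case True
      then show ?thesis using N' by blast
    next
      case False
      then obtain N'' where N'': "N'' \<subseteq> N'" "infinite N''" "acc b N''"
        unfolding rej_def by blast
      then have "\<forall>i\<in>{..card b}. decides b i N''"
        using N'(3) unfolding decides_def by (meson subset_trans)
      then show ?thesis using N' N'' by (meson subset_trans)
    qed
  qed
  then obtain M1 where M1: "M1 \<subseteq> M" "infinite M1"
    and M1_fusion: "\<forall>b\<subseteq>M1. finite b \<longrightarrow> (\<forall>i\<in>{..card b}. decides b i (beyond b M1)) \<and>
      (acc b (beyond b M1) \<or> rej b (beyond b M1))"
    unfolding beyond_def by blast
  have dec: "decides b i (beyond b M1)" if "b \<subseteq> M1" "finite b" "i \<le> card b" for b i
    using M1_fusion that by blast
  have accrej: "acc b (beyond b M1) \<or> rej b (beyond b M1)" if "b \<subseteq> M1" "finite b" for b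
    using M1_fusion that by blast
  show "\<exists>N\<subseteq>M. infinite N \<and> ((\<forall>S\<subseteq>N. infinite S \<longrightarrow> a \<union> S \<in> (\<Union>i. A i)) \<or>
      (\<forall>S\<subseteq>N. infinite S \<longrightarrow> a \<union> S \<notin> (\<Union>i. A i)))"
  proof (cases "acc {} M1")
    case True
    then show ?thesis using M1 unfolding acc_def by auto
  next
    case False
    then have rej0: "rej {} (beyond {} M1)"
      using accrej[of "{}"] by (simp add: beyond_def)
    have "\<exists>M'\<subseteq>M1. infinite M' \<and> (\<forall>b\<subseteq>M'. finite b \<longrightarrow>
      (b \<subseteq> M1 \<longrightarrow> rej b (beyond b M1) \<longrightarrow>
        (\<forall>n\<in>{n \<in> M'. \<forall>k\<in>b. k < n}. (\<forall>k\<in>b. k < n) \<longrightarrow> rej (insert n b) (beyond (insert n b) M1))))"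
    proof (rule fusion[OF M1(2)])
      fix b N :: "nat set" assume b: "finite b" and N: "N \<subseteq> M1" "infinite N"
      show "\<exists>N'\<subseteq>N. infinite N' \<and> (b \<subseteq> M1 \<longrightarrow> rej b (beyond b M1) \<longrightarrow>
        (\<forall>n\<in>N'. (\<forall>k\<in>b. k < n) \<longrightarrow> rej (insert n b) (beyond (insert n b) M1)))"
      proof (cases "b \<subseteq> M1 \<and> rej b (beyond b M1)")
        case True
        \<comment> \<open>\<open>T\<close> collects the points whose addition to \<open>b\<close> is
          accepted. An infinite \<open>S \<subseteq> T\<close> splits into its least element
          \<open>n\<close> and the rest, so acceptance of \<open>insert n b\<close> puts
          \<open>a \<union> b \<union> S\<close> in the union. Thus \<open>b\<close> accepts
          \<open>T\<close>; as \<open>b\<close> is rejected, \<open>T\<close> is finite and can be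
          discarded.\<close>
        define T where "T = {n \<in> beyond b N. acc (insert n b) (beyond (insert n b) M1)}"
        have "acc b T"
          unfolding acc_def
        proof (intro allI impI)
          fix S assume S: "S \<subseteq> T" "infinite S"
          define n where "n = Inf S"
          have "S \<noteq> {}" using S by auto
          then have n: "n \<in> S" "\<And>k. k \<in> S \<Longrightarrow> n \<le> k"
            by (auto simp: n_def Inf_nat_def1 cInf_lower)
          have "S - {n} \<subseteq> beyond (insert n b) M1"
            using S n N by (fastforce simp: T_def beyond_def order.strict_iff_order)
          moreover have "infinite (S - {n})" using S by simp
          moreover have "acc (insert n b) (beyond (insert n b) M1)"
            using n S by (auto simp: T_def)
          ultimately have "a \<union> insert n b \<union> (S - {n}) \<in> (\<Union>i. A i)"
            unfolding acc_def by blast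
          also have "a \<union> insert n b \<union> (S - {n}) = a \<union> b \<union> S" using n by blast
          finally show "a \<union> b \<union> S \<in> (\<Union>i. A i)" .
        qed
        moreover have "T \<subseteq> beyond b M1" using N by (auto simp: T_def beyond_def)
        ultimately have "finite T" using True unfolding rej_def by blast
        moreover have "rej (insert n b) (beyond (insert n b) M1)"
          if "n \<in> N - T" "\<forall>k\<in>b. k < n" for n
          using that True N b accrej[of "insert n b"] by (auto simp: T_def beyond_def)
        ultimately show ?thesis using N by (intro exI[of _ "N - T"]) auto
      next
        case False
        then show ?thesis using N by blast
      qed
    qed blast
    then obtain M2 where M2: "M2 \<subseteq> M1" "infinite M2"
      and M2_fusion: "\<forall>b\<subseteq>M2. finite b \<longrightarrow> (b \<subseteq> M1 \<longrightarrow> rej b (beyond b M1) \<longrightarrow>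
        (\<forall>n\<in>{n \<in> M2. \<forall>k\<in>b. k < n}. (\<forall>k\<in>b. k < n) \<longrightarrow> rej (insert n b) (beyond (insert n b) M1)))"
      by blast
    have step: "rej (insert n b) (beyond (insert n b) M1)"
      if "b \<subseteq> M2" "finite b" "rej b (beyond b M1)" "n \<in> M2" "\<forall>k\<in>b. k < n" for b n
      using M2_fusion that M2(1) by (simp add: subset_trans)
    have rej: "rej b (beyond b M1)" if "finite b" "b \<subseteq> M2" for b
      using that
    proof (induction b rule: finite_linorder_max_induct)
      case empty
      then show ?case using rej0 by simp
    next
      case (insert n b)
      then show ?case by (intro step) auto
    qed
    have "a \<union> S \<notin> (\<Union>i. A i)" if S: "S \<subseteq> M2" "infinite S" for S
    proof
      assume "a \<union> S \<in> (\<Union>i. A i)"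
      then obtain i where i: "a \<union> S \<in> A i" by blast
      obtain b where b: "b \<subseteq> S" "finite b" "card b = i" "\<And>k n. \<lbrakk>k \<in> b; n \<in> S - b\<rbrakk> \<Longrightarrow> k < n"
        using infinite_nat_initial_part[OF S(2)] by metis
      have sub: "S - b \<subseteq> beyond b M1" using b S M2 by (auto simp: beyond_def)
      have inf: "infinite (S - b)" using S b by simp
      have "a \<union> b \<union> (S - b) = a \<union> S" using b by blast
      then have "a \<union> b \<union> (S - b) \<in> A i" using i by simp
      \<comment> \<open>The decision for \<open>A i\<close> cannot be negative, because
        \<open>S - b\<close> is a counterexample; a positive one makes \<open>b\<close>
        accepted.\<close>
      moreover have "decides b i (beyond b M1)" using b S M2 by (intro dec) auto
      ultimately have "acc b (beyond b M1)"
        unfolding decides_def acc_def using sub inf by blast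
      then show False using rej[of b] b S sub inf unfolding rej_def
        by (meson infinite_super order_refl subset_trans)
    qed
    then show ?thesis using M1 M2 by blast
  qed
qed

section \<open>The sigma-algebra of completely Ramsey sets\<close>

lemma sigma_algebra_completely_ramsey: "sigma_algebra UNIV (Collect completely_ramsey)"
  unfolding sigma_algebra_iff2
proof (intro conjI ballI allI impI)
  show "{} \<in> Collect completely_ramsey"
    by (auto simp: completely_ramsey_def)
next
  fix A assume "A \<in> Collect completely_ramsey"
  \<comment> \<open>Complementation swaps the two alternatives of the dichotomy.\<close>
  then show "UNIV - A \<in> Collect completely_ramsey"
    unfolding completely_ramsey_def mem_Collect_eq Diff_iff by (metis UNIV_I)
next
  fix A :: "nat \<Rightarrow> nat set set" assume "range A \<subseteq> Collect completely_ramsey"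
  then show "(\<Union>i. A i) \<in> Collect completely_ramsey"
    by (auto intro!: completely_ramsey_UN)
qed simp

text \<open>Packaged as a measure space so that product measurability applies with index sets as
  points.\<close>

definition ramsey_space :: "nat set measure" where
  "ramsey_space = sigma UNIV (Collect completely_ramsey)"

lemma space_ramsey_space [simp]: "space ramsey_space = UNIV"
  by (simp add: ramsey_space_def space_measure_of_conv)

lemma sets_ramsey_space: "sets ramsey_space = Collect completely_ramsey"
  unfolding ramsey_space_def
  by (rule sigma_algebra.sets_measure_of_eq[OF sigma_algebra_completely_ramsey])

text \<open>Once \<open>{..n}\<close> is removed from \<open>M\<close>, every extension of the stem
  \<open>a\<close> has the same trace on \<open>{..n}\<close> as \<open>a\<close>, so the condition
  is constant.\<close>

lemma finitely_determined_in_ramsey_space [measurable]: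
  "{S. \<Phi> (S \<inter> {..n})} \<in> sets ramsey_space"
  unfolding sets_ramsey_space mem_Collect_eq completely_ramsey_def
proof (intro allI impI)
  fix a M :: "nat set" assume "infinite M"
  then have "infinite (M - {..n})" by simp
  moreover have "(a \<union> S) \<inter> {..n} = a \<inter> {..n}" if "S \<subseteq> M - {..n}" for S
    using that by auto
  ultimately show "\<exists>N\<subseteq>M. infinite N \<and> ((\<forall>S\<subseteq>N. infinite S \<longrightarrow> \<Phi> ((a \<union> S) \<inter> {..n})) \<or>
      (\<forall>S\<subseteq>N. infinite S \<longrightarrow> \<not> \<Phi> ((a \<union> S) \<inter> {..n})))"
    by (intro exI[of _ "M - {..n}"]) auto
qed

section \<open>Averages over initial segments of an index set\<close>

text \<open>These are the Cesaro means of \<open>f\<close> along the enumeration of \<open>S\<close>, each repeated until the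
  next element of \<open>S\<close> and preceded by zeros (\<open>0 / 0\<close>). Unlike the Cesaro means themselves, the
  \<open>n\<close>-th one depends only on \<open>S \<inter> {..n}\<close>.\<close>

definition prefix_mean :: "(nat \<Rightarrow> real \<Rightarrow> real) \<Rightarrow> nat set \<Rightarrow> nat \<Rightarrow> real \<Rightarrow> real" where
  "prefix_mean f S n = (\<lambda>x. (\<Sum>i\<in>S \<inter> {..n}. f i x) / real (card (S \<inter> {..n})))"

lemma prefix_mean_cong: "S \<inter> {..n} = T \<inter> {..n} \<Longrightarrow> prefix_mean f S n = prefix_mean f T n"
  by (simp add: prefix_mean_def)

lemma prefix_mean_range:
  assumes s: "strict_mono s" and m: "s m \<le> n" "n < s (Suc m)"
  shows "prefix_mean f (range s) n = cesaro (f \<circ> s) m"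
proof -
  have "i \<le> m" if "s i \<le> n" for i
    using that m(2) s by (metis le_less_trans less_Suc_eq_le strict_mono_less)
  moreover have "s i \<le> n" if "i \<le> m" for i
    using that m(1) s by (meson order_trans strict_mono_less_eq)
  ultimately have eq: "range s \<inter> {..n} = s ` {..m}"
    by auto
  have inj: "inj_on s {..m}" using s by (simp add: strict_mono_imp_inj_on)
  show ?thesis
    unfolding prefix_mean_def cesaro_def eq by (simp add: sum.reindex[OF inj] card_image[OF inj])
qed

lemma prefix_mean_range_cases:
  assumes s: "strict_mono s"
  obtains "n < s 0" "prefix_mean f (range s) n = (\<lambda>x. 0)"
  | m where "s m \<le> n" "n < s (Suc m)" "prefix_mean f (range s) n = cesaro (f \<circ> s) m"
proof (cases "n < s 0")
  case True
  then have "n < s i" for i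
    using s by (metis less_le_trans strict_mono_less_eq le0)
  then have "range s \<inter> {..n} = {}" by (auto dest!: leD)
  then show ?thesis using True that(1) by (simp add: prefix_mean_def)
next
  case False
  define m where "m = Max {i. s i \<le> n}"
  have fin: "finite {i. s i \<le> n}"
    by (rule finite_subset[of _ "{..n}"]) (auto intro: order_trans[OF strict_mono_imp_increasing[OF s]])
  have "m \<in> {i. s i \<le> n}" unfolding m_def using False fin by (intro Max_in) (auto simp: not_less intro: exI[of _ 0])
  moreover have "Suc m \<notin> {i. s i \<le> n}"
    using Max_ge[OF fin, of "Suc m"] by (auto simp: m_def)
  ultimately show ?thesis using that(2) prefix_mean_range[OF s] by auto
qed

text \<open>Finitely many initial zeros and finite repetitions of terms do not affect the
  limit.\<close>

lemma tendsto_prefix_mean_range_iff: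
  assumes s: "strict_mono s"
  shows "(\<lambda>n. prefix_mean f (range s) n x) \<longlonglongrightarrow> l \<longleftrightarrow> (\<lambda>m. cesaro (f \<circ> s) m x) \<longlonglongrightarrow> l"
proof
  assume "(\<lambda>n. prefix_mean f (range s) n x) \<longlonglongrightarrow> l"
  then have "((\<lambda>n. prefix_mean f (range s) n x) \<circ> s) \<longlonglongrightarrow> l"
    using s by (rule LIMSEQ_subseq_LIMSEQ)
  moreover have "prefix_mean f (range s) (s m) = cesaro (f \<circ> s) m" for m
    using s by (intro prefix_mean_range) (auto simp: strict_mono_less)
  ultimately show "(\<lambda>m. cesaro (f \<circ> s) m x) \<longlonglongrightarrow> l" by (simp add: o_def)
next
  assume L: "(\<lambda>m. cesaro (f \<circ> s) m x) \<longlonglongrightarrow> l"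
  show "(\<lambda>n. prefix_mean f (range s) n x) \<longlonglongrightarrow> l"
  proof (rule LIMSEQ_I)
    fix e :: real assume "0 < e"
    then obtain K where K: "\<And>m. m \<ge> K \<Longrightarrow> norm (cesaro (f \<circ> s) m x - l) < e"
      using LIMSEQ_D[OF L] by blast
    have "norm (prefix_mean f (range s) n x - l) < e" if n: "s K \<le> n" for n
    proof (cases rule: prefix_mean_range_cases[OF s, of n f])
      case 1
      then show ?thesis using n s by (metis leD le0 le_less_trans strict_mono_less_eq)
    next
      case (2 m)
      then have "K < Suc m" using n s by (metis le_less_trans strict_mono_less)
      then show ?thesis using 2 K by simp
    qed
    then show "\<exists>no. \<forall>n\<ge>no. norm (prefix_mean f (range s) n x - l) < e" by blast
  qed
qed

text \<open>From some \<open>b\<close> on, numerator and denominator of the mean change only by the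
  constants \<open>\<alpha>\<close> and \<open>\<beta>\<close>, which vanish after division by the
  count \<open>c n\<close>, as this tends to infinity.\<close>

lemma tendsto_prefix_mean_finite_change:
  assumes S: "infinite S" and lim: "(\<lambda>n. prefix_mean f S n x) \<longlonglongrightarrow> l"
    and F: "finite F" "S' = F \<union> (S \<inter> {k<..})"
  shows "(\<lambda>n. prefix_mean f S' n x) \<longlonglongrightarrow> l"
proof -
  define c where "c n = real (card (S \<inter> {..n}))" for n
  define \<sigma> where "\<sigma> n = (\<Sum>i\<in>S \<inter> {..n}. f i x)" for n
  obtain b where b: "F \<subseteq> {..b}" "k \<le> b"
    using F(1) by (metis finite_nat_iff_bounded_le finite_insert insert_subset atMost_iff)
  define \<alpha> where "\<alpha> = (\<Sum>i\<in>S' \<inter> {..b}. f i x) - \<sigma> b"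
  define \<beta> where "\<beta> = real (card (S' \<inter> {..b})) - c b"
  have split: "T \<inter> {..n} = (T \<inter> {..b}) \<union> (T \<inter> {b<..n})" if "n \<ge> b" for T :: "nat set" and n
    using that by auto
  have tail: "S' \<inter> {b<..n} = S \<inter> {b<..n}" for n
    using F(2) b by auto
  have sum_split: "(\<Sum>i\<in>T \<inter> {..n}. g i) = (\<Sum>i\<in>T \<inter> {..b}. g i) + (\<Sum>i\<in>T \<inter> {b<..n}. g i)"
    if "n \<ge> b" for T n and g :: "nat \<Rightarrow> real"
    unfolding split[OF that] by (rule sum.union_disjoint) auto
  have num: "(\<Sum>i\<in>S' \<inter> {..n}. f i x) = \<sigma> n + \<alpha>" if "n \<ge> b" for n
    using sum_split[OF that, of "\<lambda>i. f i x"] by (simp add: \<alpha>_def \<sigma>_def tail)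
  have den: "real (card (S' \<inter> {..n})) = c n + \<beta>" if "n \<ge> b" for n
    using sum_split[OF that, of "\<lambda>i. 1"] by (simp add: \<beta>_def c_def tail)
  have c_top: "filterlim c at_top sequentially"
    unfolding filterlim_at_top
  proof
    fix Z :: real
    obtain B where B: "B \<subseteq> S" "finite B" "card B = nat \<lceil>Z\<rceil>"
      using infinite_arbitrarily_large[OF S] by metis
    obtain n0 where n0: "B \<subseteq> {..n0}" using B(2) finite_nat_iff_bounded_le by blast
    have "Z \<le> c n" if "n \<ge> n0" for n
    proof -
      have "card B \<le> card (S \<inter> {..n})" using B n0 that by (intro card_mono) auto
      then show ?thesis using B(3) unfolding c_def by linarith
    qed
    then show "\<forall>\<^sub>F n in sequentially. Z \<le> c n" by (auto simp: eventually_sequentially)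
  qed
  then have small: "(\<lambda>n. d / c n) \<longlonglongrightarrow> 0" for d
    by (intro tendsto_divide_0[OF tendsto_const] filterlim_at_top_imp_at_infinity)
  have "(\<lambda>n. (prefix_mean f S n x + \<alpha> / c n) / (1 + \<beta> / c n)) \<longlonglongrightarrow> (l + 0) / (1 + 0)"
    by (intro tendsto_intros lim small) simp
  moreover have "\<forall>\<^sub>F n in sequentially.
      (prefix_mean f S n x + \<alpha> / c n) / (1 + \<beta> / c n) = prefix_mean f S' n x"
    using eventually_ge_at_top[of b] c_top[unfolded filterlim_at_top, rule_format, of 1]
  proof eventually_elim
    case (elim n)
    then have "(prefix_mean f S n x + \<alpha> / c n) / (1 + \<beta> / c n) = ((\<sigma> n + \<alpha>) / c n) / ((c n + \<beta>) / c n)"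
      by (simp add: prefix_mean_def \<sigma>_def c_def add_divide_distrib)
    also have "\<dots> = (\<sigma> n + \<alpha>) / (c n + \<beta>)" using elim by simp
    finally show ?case using elim by (simp add: prefix_mean_def num den)
  qed
  ultimately show ?thesis by (simp add: filterlim_cong)
qed

section \<open>Uniqueness of the limit of averages over subsequences\<close>

text \<open>For measurable functions, the usual pseudometric of convergence in measure on
  \<open>[0,1]\<close>; the truncation makes the constant 1 an integrable majorant.\<close>

definition trunc_dist :: "(real \<Rightarrow> real) \<Rightarrow> (real \<Rightarrow> real) \<Rightarrow> real" where
  "trunc_dist u v = (LINT x|unit_leb. min 1 \<bar>u x - v x\<bar>)"

lemma finite_measure_unit_leb: "finite_measure unit_leb"
  by (rule finite_measure_lebesgue_on) auto

lemma trunc_dist_tendsto: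
  assumes [measurable]: "\<And>n. u n \<in> borel_measurable unit_leb" "v \<in> borel_measurable unit_leb"
      "w \<in> borel_measurable unit_leb"
    and lim: "AE x in unit_leb. (\<lambda>n. u n x) \<longlonglongrightarrow> v x"
  shows "(\<lambda>n. trunc_dist (u n) w) \<longlonglongrightarrow> trunc_dist v w"
  unfolding trunc_dist_def
proof (rule integral_dominated_convergence)
  show "AE x in unit_leb. (\<lambda>n. min 1 \<bar>u n x - w x\<bar>) \<longlonglongrightarrow> min 1 \<bar>v x - w x\<bar>"
    using lim by eventually_elim (intro tendsto_intros)
  show "integrable unit_leb (\<lambda>x. 1 :: real)"
    using finite_measure_unit_leb by (simp add: finite_measure.integrable_const)
qed auto

lemma trunc_dist_eq_0D:
  assumes [measurable]: "u \<in> borel_measurable unit_leb" "v \<in> borel_measurable unit_leb"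
    and 0: "trunc_dist u v = 0"
  shows "AE x in unit_leb. u x = v x"
proof -
  have "integrable unit_leb (\<lambda>x. min 1 \<bar>u x - v x\<bar>)"
    by (rule finite_measure.integrable_const_bound[OF finite_measure_unit_leb, of _ 1]) auto
  then have "AE x in unit_leb. min 1 \<bar>u x - v x\<bar> = 0"
    using 0 unfolding trunc_dist_def by (subst (asm) integral_nonneg_eq_0_iff_AE) auto
  then show ?thesis by eventually_elim (auto simp: min_def split: if_splits)
qed

lemma trunc_dist_self [simp]: "trunc_dist u u = 0"
  by (simp add: trunc_dist_def)

lemma prefix_mean_measurable [measurable]:
  assumes [measurable]: "\<And>i. f i \<in> borel_measurable M"
  shows "prefix_mean f S n \<in> borel_measurable M"
  unfolding prefix_mean_def by measurable

text \<open>Long alternating blocks of two sets with different limits would give a set whose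
  averages do not converge in measure.\<close>

lemma prefix_mean_limit_unique:
  assumes f [measurable]: "\<And>i. f i \<in> borel_measurable unit_leb"
    and conv: "\<And>S. \<lbrakk>S \<subseteq> N0; infinite S\<rbrakk> \<Longrightarrow>
      L S \<in> borel_measurable unit_leb \<and> (AE x in unit_leb. (\<lambda>n. prefix_mean f S n x) \<longlonglongrightarrow> L S x)"
    and S: "S \<subseteq> N0" "infinite S" and T: "T \<subseteq> N0" "infinite T"
  shows "AE x in unit_leb. L S x = L T x"
proof -
  define W where "W k = (if even k then S else T)" for k :: nat
  have W: "W k \<subseteq> N0" "infinite (W k)" for k using S T by (auto simp: W_def)
  \<comment> \<open>A state is a finite set with a bound up to which membership is settled. Step
    \<open>k\<close> appends points of \<open>W k\<close> beyond the bound until the average is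
    within \<open>1 / (k + 1)\<close> of \<open>L (W k)\<close>.\<close>
  define ok where "ok p \<longleftrightarrow> fst p \<subseteq> {..snd p} \<and> fst p \<subseteq> N0" for p :: "nat set \<times> nat"
  define ext where "ext k p q \<longleftrightarrow> fst q \<inter> {..snd p} = fst p \<and> fst p \<subset> fst q \<and> snd p < snd q \<and>
    trunc_dist (prefix_mean f (fst q) (snd q)) (L (W k)) < inverse (real (Suc k))"
    for k and p q :: "nat set \<times> nat"
  have "\<exists>P. \<forall>k. ok (P k) \<and> ext k (P k) (P (Suc k))"
  proof (intro dependent_nat_choice)
    show "\<exists>p. ok p" by (intro exI[of _ "({}, 0)"]) (simp add: ok_def)
  next
    fix p :: "nat set \<times> nat" and k
    assume p: "ok p"
    obtain F n where Fn: "p = (F, n)" by (cases p)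
    \<comment> \<open>Continuing \<open>F\<close> by a tail of \<open>W k\<close> is a finite change
      of \<open>W k\<close>, so the means along \<open>V\<close> tend to \<open>L (W k)\<close>; a
      long enough piece of \<open>V\<close> is the next state.\<close>
    define V where "V = F \<union> (W k \<inter> {n<..})"
    have F: "F \<subseteq> {..n}" "F \<subseteq> N0" "finite F" using p by (auto simp: ok_def Fn intro: finite_subset)
    note [measurable] = conjunct1[OF conv[OF W]]
    have "AE x in unit_leb. (\<lambda>m. prefix_mean f V m x) \<longlonglongrightarrow> L (W k) x"
      using conjunct2[OF conv[OF W]]
      by eventually_elim (rule tendsto_prefix_mean_finite_change[OF W(2) _ F(3) V_def])
    then have "(\<lambda>m. trunc_dist (prefix_mean f V m) (L (W k))) \<longlonglongrightarrow> trunc_dist (L (W k)) (L (W k))"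
      by (intro trunc_dist_tendsto) auto
    then have ev: "\<forall>\<^sub>F m in sequentially. trunc_dist (prefix_mean f V m) (L (W k)) < inverse (real (Suc k))"
      by (rule order_tendstoD) auto
    \<comment> \<open>Including \<open>j\<close> makes the new block nonempty, so that the union of
      all blocks is infinite.\<close>
    obtain j where j: "j \<in> W k" "n < j" using W(2) by (meson infinite_nat_iff_unbounded)
    obtain m where m: "trunc_dist (prefix_mean f V m) (L (W k)) < inverse (real (Suc k))" "j \<le> m"
      using eventually_happens[OF eventually_conj[OF ev eventually_ge_at_top[of j]]] by auto
    let ?q = "(V \<inter> {..m}, m)"
    have "prefix_mean f (V \<inter> {..m}) m = prefix_mean f V m"
      by (rule prefix_mean_cong) auto
    moreover have "j \<in> V \<inter> {..m} - F" using j m F by (auto simp: V_def)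
    moreover have "V \<inter> {..m} \<inter> {..n} = F" "F \<subseteq> V \<inter> {..m}" using F j m by (auto simp: V_def)
    ultimately have "ext k p ?q" using m j by (auto simp: ext_def Fn)
    moreover have "ok ?q" using F W by (auto simp: ok_def V_def)
    ultimately show "\<exists>q. ok q \<and> ext k p q" by blast
  qed
  then obtain P where ok: "\<And>k. ok (P k)" and ext: "\<And>k. ext k (P k) (P (Suc k))" by blast
  define F n where "F k = fst (P k)" and "n k = snd (P k)" for k
  have F: "F k \<subseteq> {..n k}" "F k \<subseteq> N0" "F (Suc k) \<inter> {..n k} = F k" "F k \<subset> F (Suc k)" "n k < n (Suc k)"
    "trunc_dist (prefix_mean f (F (Suc k)) (n (Suc k))) (L (W k)) < inverse (real (Suc k))" for k
    using ok[of k] ext[of k] by (auto simp: ok_def ext_def F_def n_def)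
  have n: "strict_mono n" using F(5) by (simp add: strict_mono_Suc_iff)
  define V where "V = (\<Union>k. F k)"
  have Fle: "F (k + j) \<inter> {..n k} = F k" for k j
  proof (induction j)
    case 0
    then show ?case using F(1) by auto
  next
    case (Suc j)
    have "n k \<le> n (k + j)" using n by (simp add: strict_mono_less_eq)
    then have "F (k + Suc j) \<inter> {..n k} = F (Suc (k + j)) \<inter> {..n (k + j)} \<inter> {..n k}" by auto
    then show ?case using F(3) Suc by simp
  qed
  have mono: "F j \<subseteq> F k" if "j \<le> k" for j k
    using Fle[of j "k - j"] that by auto
  have Vn: "V \<inter> {..n k} = F k" for k
  proof
    show "V \<inter> {..n k} \<subseteq> F k"
    proof
      fix i assume "i \<in> V \<inter> {..n k}"
      then obtain j where "i \<in> F j" "i \<le> n k" by (auto simp: V_def)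
      then have "i \<in> F (k + j) \<inter> {..n k}" using mono[of j "k + j"] by auto
      then show "i \<in> F k" using Fle by blast
    qed
  qed (use F(1) in \<open>auto simp: V_def\<close>)
  have "infinite V"
  proof
    assume "finite V"
    then obtain b where "V \<subseteq> {..b}" using finite_nat_iff_bounded_le by blast
    moreover have "b \<le> n b" using n by (rule strict_mono_imp_increasing)
    ultimately have "V \<subseteq> F b" using Vn[of b] by fastforce
    then show False using F(4)[of b] by (auto simp: V_def)
  qed
  have V: "V \<subseteq> N0" "infinite V" using F(2) \<open>infinite V\<close> by (auto simp: V_def)
  have close: "trunc_dist (prefix_mean f V (n (Suc k))) (L (W k)) < inverse (real (Suc k))" for k
  proof -
    have "prefix_mean f V (n (Suc k)) = prefix_mean f (F (Suc k)) (n (Suc k))"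
      using Vn F(1) by (intro prefix_mean_cong) auto
    then show ?thesis using F(6) by simp
  qed
  note [measurable] = conjunct1[OF conv[OF V]]
  have eq: "AE x in unit_leb. L V x = L U x"
    if U: "U \<subseteq> N0" "infinite U" and r: "strict_mono r" "\<And>k. W (r k) = U" for U and r :: "nat \<Rightarrow> nat"
  proof -
    note [measurable] = conjunct1[OF conv[OF U]]
    \<comment> \<open>The ends of the blocks taken from \<open>U\<close>. Along them the means of
      the single set \<open>V\<close> approach \<open>L U\<close>, while all means of
      \<open>V\<close> converge to \<open>L V\<close>.\<close>
    define q where "q k = n (Suc (r k))" for k
    have q: "strict_mono q" using n r by (simp add: q_def strict_mono_def)
    have "(\<lambda>m. trunc_dist (prefix_mean f V m) (L U)) \<longlonglongrightarrow> trunc_dist (L V) (L U)"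
      using conjunct2[OF conv[OF V]] by (intro trunc_dist_tendsto) auto
    from LIMSEQ_subseq_LIMSEQ[OF this q]
    have 1: "(\<lambda>k. trunc_dist (prefix_mean f V (q k)) (L U)) \<longlonglongrightarrow> trunc_dist (L V) (L U)"
      by (simp add: o_def)
    have "(\<lambda>k. trunc_dist (prefix_mean f V (q k)) (L U)) \<longlonglongrightarrow> 0"
    proof (rule tendsto_sandwich[OF _ _ tendsto_const])
      show "(\<lambda>k. inverse (real (Suc k))) \<longlonglongrightarrow> 0" by (rule LIMSEQ_inverse_real_of_nat)
      show "\<forall>\<^sub>F k in sequentially. 0 \<le> trunc_dist (prefix_mean f V (q k)) (L U)"
        by (simp add: trunc_dist_def)
      show "\<forall>\<^sub>F k in sequentially. trunc_dist (prefix_mean f V (q k)) (L U) \<le> inverse (real (Suc k))"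
      proof (intro always_eventually allI)
        fix k
        have "trunc_dist (prefix_mean f V (q k)) (L U) < inverse (real (Suc (r k)))"
          using close[of "r k"] r by (simp add: q_def)
        also have "\<dots> \<le> inverse (real (Suc k))"
          using strict_mono_imp_increasing[OF r(1), of k] by (simp add: le_imp_inverse_le)
        finally show "trunc_dist (prefix_mean f V (q k)) (L U) \<le> inverse (real (Suc k))" by simp
      qed
    qed
    then have "trunc_dist (L V) (L U) = 0" using 1 LIMSEQ_unique by blast
    then show ?thesis by (intro trunc_dist_eq_0D) auto
  qed
  have "AE x in unit_leb. L V x = L S x"
    by (rule eq[OF S, of "\<lambda>k. 2 * k"]) (auto simp: strict_mono_def W_def)
  moreover have "AE x in unit_leb. L V x = L T x"
    by (rule eq[OF T, of "\<lambda>k. 2 * k + 1"]) (auto simp: strict_mono_def W_def)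
  ultimately show ?thesis by eventually_elim simp
qed

text \<open>Tail suprema will serve as the decreasing sequence that witnesses order
  convergence.\<close>

lemma tail_SUP_tendsto_0:
  fixes a :: "nat \<Rightarrow> real"
  assumes "a \<longlonglongrightarrow> 0" "\<And>k. 0 \<le> a k"
  shows "(\<lambda>n. SUP k\<in>{n..}. a k) \<longlonglongrightarrow> 0"
proof (rule LIMSEQ_I)
  fix e :: real assume "0 < e"
  then obtain K where K: "\<And>k. k \<ge> K \<Longrightarrow> \<bar>a k\<bar> < e / 2"
    using LIMSEQ_D[OF assms(1), of "e / 2"] by auto
  have "norm ((SUP k\<in>{n..}. a k) - 0) < e" if "n \<ge> K" for n
  proof -
    have le: "a k \<le> e / 2" if "k \<ge> n" for k
      using K[of k] that \<open>n \<ge> K\<close> by auto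
    have "(SUP k\<in>{n..}. a k) \<le> e / 2" by (rule cSUP_least) (use le in auto)
    moreover have "a n \<le> (SUP k\<in>{n..}. a k)"
      by (rule cSUP_upper) (use le in \<open>auto intro!: bdd_aboveI2[of _ _ "e / 2"]\<close>)
    ultimately show ?thesis using assms(2)[of n] \<open>0 < e\<close> by auto
  qed
  then show "\<exists>no. \<forall>n\<ge>no. norm ((SUP k\<in>{n..}. a k) - 0) < e" by blast
qed

section \<open>Order convergence and the order Banach-Saks property\<close>

context banach_function_space
begin

section \<open>Solidity and finite averages\<close>

lemma solid_mem:
  "\<lbrakk>f \<in> borel_measurable unit_leb; g \<in> X; AE x in unit_leb. \<bar>f x\<bar> \<le> \<bar>g x\<bar>\<rbrakk> \<Longrightarrow> f \<in> X"
  using solid unfolding ae_le_def by blast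

lemma solid_norm:
  "\<lbrakk>f \<in> borel_measurable unit_leb; g \<in> X; AE x in unit_leb. \<bar>f x\<bar> \<le> \<bar>g x\<bar>\<rbrakk> \<Longrightarrow> N f \<le> N g"
  using solid unfolding ae_le_def by blast

lemma abs_mem: "f \<in> X \<Longrightarrow> (\<lambda>x. \<bar>f x\<bar>) \<in> X"
  by (rule solid_mem) (auto dest: measurable)

lemma sum_mem: "\<lbrakk>finite I; \<And>i. i \<in> I \<Longrightarrow> f i \<in> X\<rbrakk> \<Longrightarrow> (\<lambda>x. \<Sum>i\<in>I. f i x) \<in> X"
  by (induction I rule: finite_induct) (auto simp: zero_mem add_mem)

lemma prefix_mean_mem:
  assumes "\<And>i. f i \<in> X"
  shows "prefix_mean f S n \<in> X"
proof -
  have "(\<lambda>x. inverse (real (card (S \<inter> {..n}))) * (\<Sum>i\<in>S \<inter> {..n}. f i x)) \<in> X"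
    by (intro scale_mem sum_mem) (auto simp: assms)
  then show ?thesis by (simp add: prefix_mean_def field_simps)
qed

text \<open>The pointwise limit \<open>h\<close> satisfies \<open>0 \<le> h \<le> g 0\<close> almost
  everywhere, so it lies in \<open>X\<close> by solidity. It is then a lower bound in
  \<open>X\<close>, and the infimum condition forces it to vanish.\<close>

lemma decreases_to_zero_imp_AE:
  assumes g: "decreases_to_zero X g"
  shows "AE x in unit_leb. (\<lambda>n. g n x) \<longlonglongrightarrow> 0"
proof -
  have gX: "g n \<in> X" for n using g by (simp add: decreases_to_zero_def)
  note [measurable] = measurable[OF gX]
  define h where "h x = lim (\<lambda>n. g n x)" for x
  have [measurable]: "h \<in> borel_measurable unit_leb"
    unfolding h_def by measurable
  have "AE x in unit_leb. \<forall>n. g (Suc n) x \<le> g n x" "AE x in unit_leb. \<forall>n. 0 \<le> g n x"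
    using g by (auto simp: decreases_to_zero_def ae_le_def AE_all_countable)
  then have conv: "AE x in unit_leb. (\<lambda>n. g n x) \<longlonglongrightarrow> h x \<and> 0 \<le> h x \<and> (\<forall>n. h x \<le> g n x)"
  proof eventually_elim
    case (elim x)
    then have dec: "decseq (\<lambda>n. g n x)" by (simp add: decseq_SucI)
    then obtain L where "(\<lambda>n. g n x) \<longlonglongrightarrow> L"
      using decseq_convergent[of "\<lambda>n. g n x" 0] elim by metis
    then have L: "(\<lambda>n. g n x) \<longlonglongrightarrow> h x" unfolding h_def using limI by blast
    then show ?case using decseq_ge[OF dec L] elim LIMSEQ_le_const[OF L] by blast
  qed
  have "h \<in> X"
  proof (rule solid_mem[OF _ gX[of 0]])
    show "AE x in unit_leb. \<bar>h x\<bar> \<le> \<bar>g 0 x\<bar>"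
      using conv by eventually_elim (metis abs_ge_self abs_of_nonneg order_trans)
  qed simp
  moreover have "\<forall>n. ae_le h (g n)" using conv by (simp add: ae_le_def AE_all_countable)
  ultimately have "ae_le h (\<lambda>x. 0)" using g by (simp add: decreases_to_zero_def)
  then show ?thesis
    using conv unfolding ae_le_def by eventually_elim (metis order_antisym)
qed

text \<open>Forwards, \<open>\<bar>l\<bar> + \<bar>g 0\<bar>\<close> is a bound. Backwards, the tail
  suprema of \<open>\<bar>f k - l\<bar>\<close> are dominated by \<open>2 * \<bar>h\<bar>\<close>
  and decrease to zero. Measurability of \<open>l\<close> is enough on the right, because
  \<open>\<bar>l\<bar> \<le> h\<close> passes to the limit.\<close>

lemma order_converges_iff:
  "order_converges X f l \<longleftrightarrow>
     (\<forall>n. f n \<in> X) \<and> l \<in> borel_measurable unit_leb \<and>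
     (AE x in unit_leb. (\<lambda>n. f n x) \<longlonglongrightarrow> l x) \<and> (\<exists>h\<in>X. \<forall>n. ae_le (\<lambda>x. \<bar>f n x\<bar>) h)"
  (is "_ \<longleftrightarrow> ?R")
proof
  assume "order_converges X f l"
  then obtain g where fX: "\<And>n. f n \<in> X" and l: "l \<in> X" and g: "decreases_to_zero X g"
    and le: "\<And>n. AE x in unit_leb. \<bar>f n x - l x\<bar> \<le> g n x"
    unfolding order_converges_def ae_le_def by blast
  have le': "AE x in unit_leb. \<forall>n. \<bar>f n x - l x\<bar> \<le> g n x"
    using le by (simp add: AE_all_countable)
  have "AE x in unit_leb. (\<lambda>n. f n x) \<longlonglongrightarrow> l x"
    using decreases_to_zero_imp_AE[OF g] le'
  proof eventually_elim
    case (elim x)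
    then have "(\<lambda>n. f n x - l x) \<longlonglongrightarrow> 0"
      by (intro Lim_null_comparison[OF _ elim(1)]) auto
    then show ?case by (simp add: LIM_zero_iff)
  qed
  moreover have "\<forall>n. ae_le (\<lambda>x. \<bar>f n x\<bar>) (\<lambda>x. \<bar>l x\<bar> + \<bar>g 0 x\<bar>)"
  proof
    have "AE x in unit_leb. \<forall>n. g (Suc n) x \<le> g n x"
      using g by (simp add: decreases_to_zero_def ae_le_def AE_all_countable)
    then show "ae_le (\<lambda>x. \<bar>f n x\<bar>) (\<lambda>x. \<bar>l x\<bar> + \<bar>g 0 x\<bar>)" for n
      unfolding ae_le_def using le'
    proof eventually_elim
      case (elim x)
      then have "g n x \<le> g 0 x" by (meson decseq_SucI decseqD le0)
      moreover have "\<bar>f n x - l x\<bar> \<le> g n x" using elim by blast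
      ultimately show ?case by linarith
    qed
  qed
  moreover have "(\<lambda>x. \<bar>l x\<bar> + \<bar>g 0 x\<bar>) \<in> X"
    using l g by (intro add_mem abs_mem) (auto simp: decreases_to_zero_def)
  ultimately show ?R using fX l measurable by blast
next
  assume ?R
  then obtain h where fX: "\<And>n. f n \<in> X" and l [measurable]: "l \<in> borel_measurable unit_leb"
    and lim: "AE x in unit_leb. (\<lambda>n. f n x) \<longlonglongrightarrow> l x" and h: "h \<in> X"
    and "\<forall>n. AE x in unit_leb. \<bar>f n x\<bar> \<le> h x"
    unfolding ae_le_def by blast
  then have dom: "AE x in unit_leb. \<forall>n. \<bar>f n x\<bar> \<le> h x" by (simp add: AE_all_countable)
  note [measurable] = measurable[OF fX] measurable[OF h]
  have l_le: "AE x in unit_leb. \<bar>l x\<bar> \<le> h x"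
    using lim dom
  proof eventually_elim
    case (elim x)
    have "(\<lambda>n. \<bar>f n x\<bar>) \<longlonglongrightarrow> \<bar>l x\<bar>" using elim by (intro tendsto_intros) auto
    then show ?case using elim by (intro LIMSEQ_le_const2[of "\<lambda>n. \<bar>f n x\<bar>"]) auto
  qed
  have lX: "l \<in> X" by (rule solid_mem[OF l h]) (use l_le in \<open>auto elim!: eventually_mono\<close>)
  txt \<open>Truncating at \<open>2 * \<bar>h x\<bar>\<close> keeps the supremum finite on the exceptional null set.\<close>
  define a where "a k x = min \<bar>f k x - l x\<bar> (2 * \<bar>h x\<bar>)" for k x
  define w where "w n x = (SUP k\<in>{n..}. a k x)" for n x
  have a_le: "0 \<le> a k x" "a k x \<le> 2 * \<bar>h x\<bar>" for k x by (auto simp: a_def)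
  have bdd: "bdd_above ((\<lambda>k. a k x) ` I)" for x I
    by (intro bdd_aboveI2[of _ _ "2 * \<bar>h x\<bar>"] a_le)
  have [measurable]: "w n \<in> borel_measurable unit_leb" for n
    unfolding w_def by (rule borel_measurable_cSUP) (auto simp: a_def[abs_def] bdd[unfolded a_def])
  have a_le_w: "a k x \<le> w n x" if "k \<ge> n" for k n x
    unfolding w_def using that by (intro cSUP_upper bdd) auto
  have w_nonneg: "0 \<le> w n x" for n x
    using a_le(1)[of n x] a_le_w[of n n x] by linarith
  have w_le: "w n x \<le> 2 * \<bar>h x\<bar>" for n x
    unfolding w_def by (rule cSUP_least) (auto simp: a_le)
  have "w (Suc n) x \<le> w n x" for n x
    unfolding w_def by (intro cSUP_subset_mono bdd) auto
  moreover have "w n \<in> X" for n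
  proof (rule solid_mem)
    show "(\<lambda>x. 2 * h x) \<in> X" using h by (rule scale_mem)
  qed (use w_nonneg w_le in \<open>auto simp: abs_mult\<close>)
  moreover have "ae_le u (\<lambda>x. 0)" if "\<forall>n. ae_le u (w n)" for u
  proof -
    have "AE x in unit_leb. \<forall>n. u x \<le> w n x" using that by (simp add: ae_le_def AE_all_countable)
    then show ?thesis
      unfolding ae_le_def using lim
    proof eventually_elim
      case (elim x)
      then have "(\<lambda>k. \<bar>f k x - l x\<bar>) \<longlonglongrightarrow> 0" by (intro tendsto_rabs_zero) (simp add: LIM_zero_iff)
      then have "(\<lambda>k. a k x) \<longlonglongrightarrow> 0"
        by (rule tendsto_sandwich[OF _ _ tendsto_const, rotated 2]) (auto simp: a_def)
      then have "(\<lambda>n. w n x) \<longlonglongrightarrow> 0"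
        unfolding w_def by (intro tail_SUP_tendsto_0 a_le)
      then show ?case using elim by (intro LIMSEQ_le_const[of "\<lambda>n. w n x"]) auto
    qed
  qed
  ultimately have "decreases_to_zero X w"
    by (auto simp: decreases_to_zero_def ae_le_def w_nonneg)
  moreover have "ae_le (\<lambda>x. \<bar>f n x - l x\<bar>) (w n)" for n
    unfolding ae_le_def using dom l_le
  proof eventually_elim
    case (elim x)
    have "\<bar>f n x\<bar> \<le> h x" using elim by blast
    then have "\<bar>f n x - l x\<bar> \<le> 2 * \<bar>h x\<bar>" using elim(2) by linarith
    then have "\<bar>f n x - l x\<bar> = a n x" by (simp add: a_def)
    then show ?case using a_le_w[of n n x] by simp
  qed
  ultimately show "order_converges X f l"
    unfolding order_converges_def using fX lX by blast
qed

lemma order_converges_AE_cong: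
  assumes "order_converges X f l" "AE x in unit_leb. l x = l' x" "l' \<in> borel_measurable unit_leb"
  shows "order_converges X f l'"
proof -
  have "AE x in unit_leb. (\<lambda>n. f n x) \<longlonglongrightarrow> l x"
    using assms(1) by (simp add: order_converges_iff)
  with assms(2) have "AE x in unit_leb. (\<lambda>n. f n x) \<longlonglongrightarrow> l' x"
    by eventually_elim simp
  then show ?thesis using assms by (simp add: order_converges_iff)
qed

text \<open>Allows the means along subsequences to be studied as functions of the index set, each
  depending on an initial segment only.\<close>

lemma order_converges_cesaro_iff:
  assumes f: "\<And>i. f i \<in> X" and s: "strict_mono s"
  shows "order_converges X (cesaro (f \<circ> s)) l \<longleftrightarrow> order_converges X (prefix_mean f (range s)) l"
proof -
  have eq: "cesaro (f \<circ> s) m = prefix_mean f (range s) (s m)" for m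
    using s by (subst prefix_mean_range) (auto simp: strict_mono_less)
  have "(\<forall>n. ae_le (\<lambda>x. \<bar>prefix_mean f (range s) n x\<bar>) h)"
    if h: "\<forall>m. ae_le (\<lambda>x. \<bar>cesaro (f \<circ> s) m x\<bar>) h" for h
  proof
    fix n
    show "ae_le (\<lambda>x. \<bar>prefix_mean f (range s) n x\<bar>) h"
    proof (cases rule: prefix_mean_range_cases[OF s, of n f])
      case 1
      \<comment> \<open>The extra means before \<open>s 0\<close> are zero, and a bound for absolute
        values is nonnegative almost everywhere.\<close>
      have "AE x in unit_leb. \<bar>cesaro (f \<circ> s) 0 x\<bar> \<le> h x" using h by (simp add: ae_le_def)
      then show ?thesis unfolding ae_le_def 1 by (auto elim!: eventually_mono)
    next
      case (2 m)
      then show ?thesis using h by simp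
    qed
  qed
  then have "(\<forall>m. ae_le (\<lambda>x. \<bar>cesaro (f \<circ> s) m x\<bar>) h) \<longleftrightarrow>
      (\<forall>n. ae_le (\<lambda>x. \<bar>prefix_mean f (range s) n x\<bar>) h)" for h
    unfolding eq by blast
  moreover have "cesaro (f \<circ> s) m \<in> X" "prefix_mean f (range s) m \<in> X" for m
    unfolding eq by (intro prefix_mean_mem f)+
  ultimately show ?thesis
    unfolding order_converges_iff tendsto_prefix_mean_range_iff[OF s] by simp
qed

text \<open>The Cesaro means of a subsequence of an increasing sequence have the same pointwise
  limit, so their order limit is an upper bound.\<close>

lemma oBSP_increasing_bounded:
  assumes oBSP: "oBSP X N" and uX: "\<And>n. u n \<in> X"
    and nonneg: "\<And>n x. 0 \<le> u n x" and inc: "\<And>x. incseq (\<lambda>n. u n x)"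
    and K: "\<And>n. N (u n) \<le> K"
  shows "\<exists>h\<in>X. \<forall>n. ae_le (u n) h"
proof -
  have "norm_bounded_seq X N u" using uX K by (auto simp: norm_bounded_seq_def)
  then obtain r l where r: "strict_mono r" and l: "order_converges X (cesaro (u \<circ> r)) l"
    using oBSP unfolding oBSP_def by blast
  have lim: "AE x in unit_leb. (\<lambda>m. cesaro (u \<circ> r) m x) \<longlonglongrightarrow> l x"
    using l by (simp add: order_converges_iff)
  have "ae_le (u n) l" for n
    unfolding ae_le_def using lim
  proof eventually_elim
    case (elim x)
    \<comment> \<open>As \<open>r i \<ge> i\<close>, each of the \<open>Suc m - n\<close> terms with
      index from \<open>n\<close> to \<open>m\<close> is at least \<open>u n x\<close>; the
      remaining ones are nonnegative. The factor tends to 1 with \<open>m\<close>.\<close>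
    have "(1 - real n / real (Suc m)) * u n x \<le> cesaro (u \<circ> r) m x" if "n \<le> m" for m
    proof -
      have "real (Suc m - n) * u n x = (\<Sum>i\<in>{n..m}. u n x)" by simp
      also have "\<dots> \<le> (\<Sum>i\<in>{n..m}. u (r i) x)"
        using strict_mono_imp_increasing[OF r] inc by (intro sum_mono) (meson atLeastAtMost_iff incseqD order_trans)
      also have "\<dots> \<le> (\<Sum>i\<le>m. u (r i) x)"
        by (intro sum_mono2) (auto simp: nonneg)
      finally have "(real (Suc m) - real n) * u n x \<le> (\<Sum>i\<le>m. u (r i) x)"
        using that by (simp add: of_nat_diff Suc_diff_le algebra_simps)
      then have "(real (Suc m) - real n) * u n x / real (Suc m) \<le> (\<Sum>i\<le>m. u (r i) x) / real (Suc m)"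
        by (intro divide_right_mono) auto
      moreover have "(real (Suc m) - real n) * u n x / real (Suc m) = (1 - real n / real (Suc m)) * u n x"
        by (simp add: field_simps del: of_nat_Suc)
      ultimately show ?thesis by (simp add: cesaro_def)
    qed
    then have "\<exists>K. \<forall>m\<ge>K. (1 - real n / real (Suc m)) * u n x \<le> cesaro (u \<circ> r) m x" by blast
    moreover have "(\<lambda>m. (1 - real n / real (Suc m)) * u n x) \<longlonglongrightarrow> (1 - 0) * u n x"
      by (intro tendsto_intros LIMSEQ_Suc[OF lim_const_over_n])
    ultimately show ?case
      using elim LIMSEQ_le by fastforce
  qed
  moreover have "l \<in> X" using l by (simp add: order_converges_def)
  ultimately show ?thesis by blast
qed

text \<open>A common bound dominates all finite maxima, hence bounds their norms; conversely the
  maxima increase, so \<open>oBSP\<close> bounds them in order. This replaces a quantifier over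
  \<open>X\<close> by countable ones, with \<open>K\<close> a natural number for that
  reason.\<close>

lemma dominated_iff_norm_bounded_maxima:
  fixes p :: "nat \<Rightarrow> real \<Rightarrow> real"
  assumes oBSP: "oBSP X N" and pX: "\<And>n. p n \<in> X"
  shows "(\<exists>h\<in>X. \<forall>n. ae_le (\<lambda>x. \<bar>p n x\<bar>) h) \<longleftrightarrow>
    (\<exists>K::nat. \<forall>n. N (\<lambda>x. Max ((\<lambda>j. \<bar>p j x\<bar>) ` {..n})) \<le> real K)"
proof -
  note [measurable] = measurable[OF pX]
  define u where "u n x = Max ((\<lambda>j. \<bar>p j x\<bar>) ` {..n})" for n x
  have [measurable]: "u n \<in> borel_measurable unit_leb" for n
    unfolding u_def by (rule borel_measurable_Max) simp_all
  have p_le: "\<bar>p j x\<bar> \<le> u n x" if "j \<le> n" for j n x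
    unfolding u_def using that by (intro Max_ge) auto
  have nonneg: "0 \<le> u n x" for n x
    using p_le[of n n x] by linarith
  have uX: "u n \<in> X" for n
  proof (rule solid_mem)
    show sX: "(\<lambda>x. \<Sum>j\<le>n. \<bar>p j x\<bar>) \<in> X" by (intro sum_mem abs_mem pX) auto
    have "u n x \<le> (\<Sum>j\<le>n. \<bar>p j x\<bar>)" for x
      unfolding u_def by (auto intro!: member_le_sum)
    then show "AE x in unit_leb. \<bar>u n x\<bar> \<le> \<bar>\<Sum>j\<le>n. \<bar>p j x\<bar>\<bar>"
      using nonneg by (auto simp: sum_nonneg)
  qed simp
  have norm_bounded: "\<exists>K::nat. \<forall>n. N (u n) \<le> real K" if h: "h \<in> X" "\<forall>n. ae_le (\<lambda>x. \<bar>p n x\<bar>) h" for h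
  proof -
    have "N (u n) \<le> N h" for n
    proof (rule solid_norm)
      have "AE x in unit_leb. \<forall>j. \<bar>p j x\<bar> \<le> h x"
        using h by (simp add: ae_le_def AE_all_countable)
      then show "AE x in unit_leb. \<bar>u n x\<bar> \<le> \<bar>h x\<bar>"
      proof eventually_elim
        case (elim x)
        then have "u n x \<le> h x" by (auto simp: u_def)
        then show ?case using nonneg[of n x] by simp
      qed
    qed (use h in auto)
    moreover obtain K :: nat where "N h \<le> real K" using real_arch_simple by blast
    ultimately show ?thesis by (meson order_trans)
  qed
  have dominated: "\<exists>h\<in>X. \<forall>n. ae_le (\<lambda>x. \<bar>p n x\<bar>) h" if K: "\<forall>n. N (u n) \<le> real K" for K :: nat
  proof -
    have "incseq (\<lambda>n. u n x)" for x
      unfolding u_def by (intro incseq_SucI Max_mono) auto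
    then obtain h where h: "h \<in> X" "\<forall>n. ae_le (u n) h"
      using oBSP_increasing_bounded[of u "real K"] oBSP uX nonneg K by blast
    have "ae_le (\<lambda>x. \<bar>p n x\<bar>) h" for n
      using h(2)[rule_format, of n] unfolding ae_le_def
      by eventually_elim (rule order_trans[OF p_le[OF order_refl]])
    then show ?thesis using h(1) by blast
  qed
  have u: "(\<lambda>x. Max ((\<lambda>j. \<bar>p j x\<bar>) ` {..n})) = u n" for n
    by (simp add: u_def fun_eq_iff)
  show ?thesis
    unfolding u by (rule iffI; elim bexE exE; rule norm_bounded dominated; assumption)
qed

text \<open>The set is the intersection of the convergence condition and the domination condition of
  \<open>order_converges_iff\<close>; each belongs to the sigma-algebra of completely Ramsey
  sets.\<close>

lemma order_convergence_set_completely_ramsey: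
  assumes oBSP: "oBSP X N" and f: "\<And>i. f i \<in> X"
  shows "completely_ramsey {S. \<exists>l. order_converges X (prefix_mean f S) l}"
proof -
  note [measurable] = measurable[OF f]
  interpret finite_measure unit_leb by (rule finite_measure_unit_leb)
  have [measurable]: "{S. i \<in> S} \<in> sets ramsey_space" for i
    using finitely_determined_in_ramsey_space[of "\<lambda>F. i \<in> F" i] by simp
  have pX: "prefix_mean f S n \<in> X" for S n
    by (intro prefix_mean_mem f)
  have dom: "(\<exists>h\<in>X. \<forall>n. ae_le (\<lambda>x. \<bar>prefix_mean f S n x\<bar>) h) \<longleftrightarrow>
      (\<exists>K::nat. \<forall>n. N (\<lambda>x. Max ((\<lambda>j. \<bar>prefix_mean f S j x\<bar>) ` {..n})) \<le> real K)" for S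
    by (intro dominated_iff_norm_bounded_maxima oBSP pX)
  \<comment> \<open>Indicators make the mean visibly measurable jointly in the index set and the
    point.\<close>
  define p where "p n z = (\<Sum>i\<le>n. indicator {S. i \<in> S} (fst z) * f i (snd z)) /
      (\<Sum>i\<le>n. indicator {S. i \<in> S} (fst z))" for n and z :: "nat set \<times> real"
  have p: "p n (S, x) = prefix_mean f S n x" for n S x
  proof -
    have "(\<Sum>i\<le>n. indicator {S. i \<in> S} S * g i) = (\<Sum>i\<in>S \<inter> {..n}. g i)" for g :: "nat \<Rightarrow> real"
      by (simp add: indicator_def if_distrib sum.inter_restrict Int_commute
               flip: of_bool_def cong: if_cong)
    from this[of "\<lambda>i. f i x"] this[of "\<lambda>i. 1"] show ?thesis
      by (simp add: p_def prefix_mean_def)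
  qed
  have [measurable]: "p n \<in> borel_measurable (ramsey_space \<Otimes>\<^sub>M unit_leb)" for n
    unfolding p_def by measurable
  define B where "B = {z \<in> space (ramsey_space \<Otimes>\<^sub>M unit_leb). \<not> Cauchy (\<lambda>n. p n z)}"
  have "B \<in> sets (ramsey_space \<Otimes>\<^sub>M unit_leb)" unfolding B_def by measurable
  \<comment> \<open>The measure of a section of a product measurable set depends measurably on
    \<open>S\<close>. The section of \<open>B\<close> at \<open>S\<close> is the set of points where
    the means diverge.\<close>
  then have "{S \<in> space ramsey_space. emeasure unit_leb (Pair S -` B) = 0} \<in> sets ramsey_space"
    using measurable_emeasure_Pair by measurable
  moreover have "emeasure unit_leb (Pair S -` B) = 0 \<longleftrightarrow>
      (\<exists>l\<in>borel_measurable unit_leb. AE x in unit_leb. (\<lambda>n. prefix_mean f S n x) \<longlonglongrightarrow> l x)" for S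
  proof -
    have B: "Pair S -` B = {x \<in> space unit_leb. \<not> Cauchy (\<lambda>n. prefix_mean f S n x)}"
      by (auto simp: B_def p space_pair_measure)
    have "emeasure unit_leb (Pair S -` B) = 0 \<longleftrightarrow> (AE x in unit_leb. Cauchy (\<lambda>n. prefix_mean f S n x))"
      unfolding B
      by (intro AE_iff_measurable[symmetric] sets.sets_Collect_neg sets_Collect_Cauchy
          prefix_mean_measurable measurable[OF f] refl)
    also have "\<dots> \<longleftrightarrow> (\<exists>l\<in>borel_measurable unit_leb. AE x in unit_leb. (\<lambda>n. prefix_mean f S n x) \<longlonglongrightarrow> l x)"
    proof
      assume "AE x in unit_leb. Cauchy (\<lambda>n. prefix_mean f S n x)"
      then show "\<exists>l\<in>borel_measurable unit_leb. AE x in unit_leb. (\<lambda>n. prefix_mean f S n x) \<longlonglongrightarrow> l x"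
        by (intro bexI[of _ "\<lambda>x. lim (\<lambda>n. prefix_mean f S n x)"])
           (auto elim!: eventually_mono simp: Cauchy_convergent_iff convergent_LIMSEQ_iff)
    qed (auto elim!: eventually_mono intro: LIMSEQ_imp_Cauchy)
    finally show ?thesis .
  qed
  moreover have "{S. \<exists>K::nat. \<forall>n. N (\<lambda>x. Max ((\<lambda>j. \<bar>prefix_mean f S j x\<bar>) ` {..n})) \<le> real K} \<in> sets ramsey_space"
  proof -
    have "{S. N (\<lambda>x. Max ((\<lambda>j. \<bar>prefix_mean f S j x\<bar>) ` {..n})) \<le> real K} \<in> sets ramsey_space" for n K
    proof -
      \<comment> \<open>The maximum over \<open>j \<le> n\<close> sees only
        \<open>S \<inter> {..n}\<close>, so each norm bound is a finitely determined
        condition.\<close>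
      have "prefix_mean f (S \<inter> {..n}) j = prefix_mean f S j" if "j \<le> n" for S j
        using that by (intro prefix_mean_cong) auto
      then have "(\<lambda>j. \<bar>prefix_mean f (S \<inter> {..n}) j x\<bar>) ` {..n} = (\<lambda>j. \<bar>prefix_mean f S j x\<bar>) ` {..n}" for S x
        by (intro image_cong) auto
      then show ?thesis
        using finitely_determined_in_ramsey_space
          [of "\<lambda>S. N (\<lambda>x. Max ((\<lambda>j. \<bar>prefix_mean f S j x\<bar>) ` {..n})) \<le> real K" n] by simp
    qed
    then have "(\<Union>K::nat. \<Inter>n. {S. N (\<lambda>x. Max ((\<lambda>j. \<bar>prefix_mean f S j x\<bar>) ` {..n})) \<le> real K}) \<in> sets ramsey_space"
      by (intro sets.countable_UN sets.countable_INT) auto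
    also have "(\<Union>K::nat. \<Inter>n. {S. N (\<lambda>x. Max ((\<lambda>j. \<bar>prefix_mean f S j x\<bar>) ` {..n})) \<le> real K}) =
      {S. \<exists>K::nat. \<forall>n. N (\<lambda>x. Max ((\<lambda>j. \<bar>prefix_mean f S j x\<bar>) ` {..n})) \<le> real K}" by blast
    finally show ?thesis .
  qed
  ultimately have "{S. \<exists>l\<in>borel_measurable unit_leb. AE x in unit_leb. (\<lambda>n. prefix_mean f S n x) \<longlonglongrightarrow> l x} \<inter>
      {S. \<exists>K::nat. \<forall>n. N (\<lambda>x. Max ((\<lambda>j. \<bar>prefix_mean f S j x\<bar>) ` {..n})) \<le> real K} \<in> sets ramsey_space"
    by (intro sets.Int) simp_all
  also have "{S. \<exists>l\<in>borel_measurable unit_leb. AE x in unit_leb. (\<lambda>n. prefix_mean f S n x) \<longlonglongrightarrow> l x} \<inter>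
      {S. \<exists>K::nat. \<forall>n. N (\<lambda>x. Max ((\<lambda>j. \<bar>prefix_mean f S j x\<bar>) ` {..n})) \<le> real K} =
      {S. \<exists>l. order_converges X (prefix_mean f S) l}"
    unfolding order_converges_iff dom by (auto simp: pX)
  finally show ?thesis by (simp add: sets_ramsey_space)
qed

section \<open>Equivalence of the two properties\<close>

lemma oBSP_imp_hoBSP:
  assumes oBSP: "oBSP X N"
  shows "hoBSP X N"
  unfolding hoBSP_def
proof (intro allI impI)
  fix f assume bounded: "norm_bounded_seq X N f"
  then have f: "f i \<in> X" for i by (simp add: norm_bounded_seq_def)
  obtain M where M: "infinite M"
    and dichotomy: "(\<forall>S\<subseteq>M. infinite S \<longrightarrow> (\<exists>l. order_converges X (prefix_mean f S) l)) \<or>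
      (\<forall>S\<subseteq>M. infinite S \<longrightarrow> \<not> (\<exists>l. order_converges X (prefix_mean f S) l))"
    using order_convergence_set_completely_ramsey[where f = f, OF oBSP f, unfolded completely_ramsey_def,
        rule_format, of "{}" UNIV] by auto
  define r where "r = enumerate M"
  have r: "strict_mono r" "range r = M"
    using M by (simp_all add: r_def strict_mono_enumerate range_enumerate)
  have range_comp: "range (r \<circ> s) \<subseteq> M" "infinite (range (r \<circ> s))" "strict_mono (r \<circ> s)"
    if "strict_mono s" for s :: "nat \<Rightarrow> nat"
  proof -
    show "strict_mono (r \<circ> s)" using r that by (simp add: strict_mono_o)
    then show "infinite (range (r \<circ> s))"
      by (intro range_inj_infinite strict_mono_imp_inj_on)
  qed (use r in auto)
  \<comment> \<open>Applied along \<open>r\<close>, \<open>oBSP\<close> yields one infinite subset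
    of \<open>M\<close> with order convergent means, which excludes the negative
    alternative.\<close>
  have "norm_bounded_seq X N (f \<circ> r)" using bounded by (auto simp: norm_bounded_seq_def)
  then obtain s l where "strict_mono s" "order_converges X (cesaro (f \<circ> (r \<circ> s))) l"
    using oBSP unfolding oBSP_def by (metis comp_assoc)
  then have "order_converges X (prefix_mean f (range (r \<circ> s))) l"
    using order_converges_cesaro_iff f range_comp(3) by blast
  then have all: "\<exists>l. order_converges X (prefix_mean f S) l" if "S \<subseteq> M" "infinite S" for S
    using dichotomy range_comp \<open>strict_mono s\<close> that by blast
  define L where "L S = (SOME l. order_converges X (prefix_mean f S) l)" for S
  have L: "order_converges X (prefix_mean f S) (L S)" if "S \<subseteq> M" "infinite S" for S
    unfolding L_def using all[OF that] by (rule someI_ex)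
  have "order_converges X (cesaro (f \<circ> r \<circ> s)) (L M)" if s: "strict_mono s" for s
  proof -
    note S = range_comp[OF s]
    \<comment> \<open>\<open>M\<close> is itself one of the index sets, so \<open>L M\<close> can
      serve as the common limit.\<close>
    have "AE x in unit_leb. L (range (r \<circ> s)) x = L M x"
      by (rule prefix_mean_limit_unique[where ?N0.0 = M and f = f])
         (use L S M measurable[OF f] in \<open>auto simp: order_converges_iff\<close>)
    then have "order_converges X (prefix_mean f (range (r \<circ> s))) (L M)"
      using L[OF order_refl M]
      by (intro order_converges_AE_cong[OF L[OF S(1,2)]]) (simp_all add: order_converges_iff)
    then show ?thesis
      using order_converges_cesaro_iff[OF f S(3)] by (simp add: comp_assoc)
  qed
  then show "\<exists>r :: nat \<Rightarrow> nat. strict_mono r \<and>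
      (\<exists>l. \<forall>s :: nat \<Rightarrow> nat. strict_mono s \<longrightarrow> order_converges X (cesaro (f \<circ> r \<circ> s)) l)"
    using r by blast
qed

lemma hoBSP_imp_oBSP:
  assumes "hoBSP X N"
  shows "oBSP X N"
  unfolding oBSP_def
proof (intro allI impI)
  fix f assume "norm_bounded_seq X N f"
  then obtain r :: "nat \<Rightarrow> nat" and l where "strict_mono r"
    and l: "\<And>s :: nat \<Rightarrow> nat. strict_mono s \<Longrightarrow> order_converges X (cesaro (f \<circ> r \<circ> s)) l"
    using assms unfolding hoBSP_def by blast
  \<comment> \<open>The identity, as the further subsequence, gives back
    \<open>f \<circ> r\<close>.\<close>
  then show "\<exists>r. strict_mono r \<and> (\<exists>l. order_converges X (cesaro (f \<circ> r)) l)"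
    using l[of id] by (auto simp: strict_mono_def)
qed

end

theorem theorem4p7:
  fixes X :: "(real \<Rightarrow> real) set" and N :: "(real \<Rightarrow> real) \<Rightarrow> real"
  assumes "banach_function_space X N"
  shows "oBSP X N \<longleftrightarrow> hoBSP X N"
  using banach_function_space.oBSP_imp_hoBSP[OF assms] banach_function_space.hoBSP_imp_oBSP[OF assms]
  by blast

end
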